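(* Let $\ell \geq 1$, $s \geq 0$, $M \geq 0$ with $M \geq s$ be integers. Then \[ \sum_{n=s}^{M} (-1)^{n} (2\ell n +1) \left(\ell^2n^2 + \ell n + 1 -\ell^2 s^2 \right) \frac{\left(\frac{1}{\ell}\right)_{n+s} \left(\frac{1}{\ell}\right)_{n-s} \left(\frac{1}{\ell}\right)_{n}}{(1)_{n+s} (1)_{n-s} (1)_{n}} = (-1)^{M} \frac{\left(1+\frac{1}{\ell}\right)_{M+s} \left(1+\frac{1}{\ell}\right)_{M-s} \left(1+\frac{1}{\ell}\right)_{M}}{(1)_{M+s} (1)_{M-s} (1)_{M}}. \]
   Context: For a real number $a$ and integer $n\ge 0$, the rising factorial is $(a)_0=1$ and $(a)_n=a(a+1)\cdots(a+n-1)$ for $n\geq 1$. *)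

theory Defs
  imports Complex_Main
begin

end

theory Submission
  imports Defs
begin

text \<open>
  The sum telescopes. With \<open>x = l n\<close> and \<open>y = l s\<close>, the polynomial factor of the summand splits as
  \<open>(2 x + 1) (x\<^sup>2 + x + 1 - y\<^sup>2) = (1 + x) ((1 + x)\<^sup>2 - y\<^sup>2) + x (x\<^sup>2 - y\<^sup>2)\<close>.
  Multiplied by the quotients of rising factorials, the first part is the right-hand side at \<open>n\<close>
  and the second is the right-hand side at \<open>n - 1\<close> without its sign; the second part
  vanishes at \<open>n = s\<close>.
\<close>

text \<open>Splitting off either the first or the last factor of
  \<open>pochhammer (1 / c) (Suc n)\<close> gives two products with the same value.\<close>

lemma pochhammer_inverse_ratio_same:
  fixes c :: real
  assumes "c \<noteq> 0"
  shows "pochhammer (1 + 1 / c) n / pochhammer 1 n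
    = (1 + c * real n) * (pochhammer (1 / c) n / pochhammer 1 n)"
proof -
  have "1 / c * pochhammer (1 + 1 / c) n = (1 / c + real n) * pochhammer (1 / c) n"
    using pochhammer_rec[of "1 / c" n] pochhammer_rec'[of "1 / c" n] by (simp add: add.commute)
  then have "pochhammer (1 + 1 / c) n = c * (1 / c + real n) * pochhammer (1 / c) n"
    using assms by (simp add: field_simps)
  then show ?thesis
    using assms by (simp add: distrib_left)
qed

text \<open>Here the first factor \<open>1 / c\<close> leaves the numerator and the last factor
  \<open>Suc n\<close> leaves the denominator. This raises the index by one, so the right-hand side
  at \<open>n - 1\<close> can be compared with the summand at \<open>n\<close>.\<close>

lemma pochhammer_inverse_ratio_Suc:
  fixes c :: real
  assumes "c \<noteq> 0"
  shows "pochhammer (1 + 1 / c) n / pochhammer 1 n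
    = c * real (Suc n) * (pochhammer (1 / c) (Suc n) / pochhammer 1 (Suc n))"
proof -
  have "pochhammer (1 / c) (Suc n) = 1 / c * pochhammer (1 + 1 / c) n"
    using pochhammer_rec[of "1 / c" n] by (simp add: add.commute)
  moreover have "pochhammer (1::real) (Suc n) = real (Suc n) * pochhammer 1 n"
    by (simp add: pochhammer_rec')
  ultimately show ?thesis
    using assms by simp
qed

lemma telescoping_sum_pochhammer_ratios:
  fixes c :: real
  assumes "c \<noteq> 0"
  defines "r \<equiv> \<lambda>n. pochhammer (1 / c) n / pochhammer 1 n"
    and "R \<equiv> \<lambda>n. pochhammer (1 + 1 / c) n / pochhammer 1 n"
  assumes "s \<le> M"
  shows "(\<Sum>n = s..M. (-1) ^ n * (2 * c * real n + 1)
            * (c\<^sup>2 * (real n)\<^sup>2 + c * real n + 1 - c\<^sup>2 * (real s)\<^sup>2)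
            * (r (n + s) * r (n - s) * r n))
       = (-1) ^ M * (R (M + s) * R (M - s) * R M)"
  using \<open>s \<le> M\<close>
proof (induction M rule: dec_induct)
  case base
  have same: "R n = (1 + c * real n) * r n" for n
    using pochhammer_inverse_ratio_same[OF \<open>c \<noteq> 0\<close>] by (simp add: R_def r_def)
  \<comment> \<open>At \<open>n = s\<close> the polynomial factor is
    \<open>(1 + 2 * c * s) * (1 + c * s)\<close>, which is what \<open>same\<close> yields at the
    indices \<open>2 * s\<close>, \<open>0\<close> and \<open>s\<close>.\<close>
  show ?case
    by (simp add: same) (simp add: algebra_simps)
next
  case (step M)
  have same: "R n = (1 + c * real n) * r n" for n
    using pochhammer_inverse_ratio_same[OF \<open>c \<noteq> 0\<close>] by (simp add: R_def r_def)
  have Suc: "R n = c * real (Suc n) * r (Suc n)" for n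
    using pochhammer_inverse_ratio_Suc[OF \<open>c \<noteq> 0\<close>] by (simp add: R_def r_def)
  define m where "m = real (Suc M)"
  \<comment> \<open>Both closed forms become a polynomial in \<open>m\<close> times
    \<open>p\<close>: the one at \<open>M\<close> through \<open>Suc\<close>, the one at
    \<open>Suc M\<close> through \<open>same\<close>.\<close>
  define p where "p = r (Suc M + s) * r (Suc M - s) * r (Suc M)"
  have old: "R (M + s) * R (M - s) * R M = c ^ 3 * ((m + real s) * (m - real s) * m) * p"
    using \<open>s \<le> M\<close>
    by (simp add: Suc p_def m_def Suc_diff_le of_nat_diff power3_eq_cube algebra_simps)
  have new: "R (Suc M + s) * R (Suc M - s) * R (Suc M)
      = (1 + c * (m + real s)) * (1 + c * (m - real s)) * (1 + c * m) * p"
    using \<open>s \<le> M\<close> by (simp only: same p_def m_def of_nat_add of_nat_diff le_SucI mult_ac)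
  have split: "(2 * c * m + 1) * (c\<^sup>2 * m\<^sup>2 + c * m + 1 - c\<^sup>2 * (real s)\<^sup>2)
      = (1 + c * (m + real s)) * (1 + c * (m - real s)) * (1 + c * m)
        + c ^ 3 * ((m + real s) * (m - real s) * m)"
    by algebra
  have "(\<Sum>n = s..Suc M. (-1) ^ n * (2 * c * real n + 1)
            * (c\<^sup>2 * (real n)\<^sup>2 + c * real n + 1 - c\<^sup>2 * (real s)\<^sup>2)
            * (r (n + s) * r (n - s) * r n))
      = (-1) ^ M * (R (M + s) * R (M - s) * R M)
        + (-1) ^ Suc M * ((2 * c * m + 1) * (c\<^sup>2 * m\<^sup>2 + c * m + 1 - c\<^sup>2 * (real s)\<^sup>2)) * p"
    using step.IH \<open>s \<le> M\<close> by (simp add: p_def m_def mult.assoc)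
  \<comment> \<open>The second part of \<open>split\<close> carries the sign opposite to that of
    \<open>old\<close> and cancels it; the first part is \<open>new\<close>.\<close>
  also have "\<dots> = (-1) ^ Suc M * (R (Suc M + s) * R (Suc M - s) * R (Suc M))"
    unfolding old new split by (simp add: algebra_simps)
  finally show ?case .
qed

theorem theorem1p1:
  fixes l s M :: nat
  assumes "l \<ge> 1" and "s \<ge> 0" and "M \<ge> 0" and "M \<ge> s"
  shows "(\<Sum>n = s..M. (-1) ^ n * (2 * real l * real n + 1)
            * ((real l)\<^sup>2 * (real n)\<^sup>2 + real l * real n + 1 - (real l)\<^sup>2 * (real s)\<^sup>2)
            * ((pochhammer (1 / real l) (n + s) * pochhammer (1 / real l) (n - s) * pochhammer (1 / real l) n)
               / (pochhammer 1 (n + s) * pochhammer 1 (n - s) * pochhammer 1 n)))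
       = (-1) ^ M
            * ((pochhammer (1 + 1 / real l) (M + s) * pochhammer (1 + 1 / real l) (M - s) * pochhammer (1 + 1 / real l) M)
               / (pochhammer 1 (M + s) * pochhammer 1 (M - s) * pochhammer 1 M))"
proof -
  have "real l \<noteq> 0"
    using \<open>l \<ge> 1\<close> by simp
  from telescoping_sum_pochhammer_ratios[OF this \<open>M \<ge> s\<close>] show ?thesis
    by simp
qed

end
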